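(* Let $\gamma,\eta,\omega,\lambda\in\mathbb{R}$, $a\in\mathbb{C}$, $k\in\mathbb{Z}$, $m\in\mathbb{N}$ and $b,c\in\mathbb{N}_0$. Then the generalized Apostol-Bernoulli poly-Daehee polynomials satisfy the implicit summation formula $${}_{\mathfrak{B}}\mathfrak{D}_{b+c,a}^{[k,m-1]}(\gamma,\eta;\lambda)=\sum_{n=0}^{b}\sum_{q=0}^{c}\binom{b}{n}\binom{c}{q}(\eta-\omega)^{n+q}\;{}_{\mathfrak{B}}\mathfrak{D}_{b+c-n-q,a}^{[k,m-1]}(\gamma,\omega;\lambda)$$ (with $0^0=1$).
   Context: $\mathbb{N}=\{1,2,\dots\}$, $\mathbb{N}_0=\mathbb{N}\cup\{0\}$. The polylogarithm is $\mathrm{Li}_k(z)=\sum_{r=1}^{\infty} z^r/r^k$. Generalized Apostol-Bernoulli poly-Daehee polynomials (GABPDP), defined by the generating function $$(1+x)^{\gamma}\,\frac{\log(1+x)}{\mathrm{Li}_k(1-e^{-x})}\,e^{\eta x}\left(\frac{x^m}{\lambda e^x-\sum_{l=0}^{m-1}\frac{x^l}{l!}}\right)^{a}=\sum_{n=0}^\infty {}_{\mathfrak{B}}\mathfrak{D}_{n,a}^{[k,m-1]}(\gamma,\eta;\lambda)\frac{x^n}{n!}.$$ *)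

theory Defs
  imports "HOL-Analysis.Analysis"
begin

text \<open>
  Generating functions are read as formal power series over the complex numbers.

  The complex power of \<open>f = X^d * u\<close>, where \<open>d\<close> is the subdegree of \<open>f\<close> and \<open>u\<close> has a nonzero
  constant term \<open>u0\<close>, is \<open>X^(d*a) * u0^a * (1 + (u/u0 - 1))^a\<close>, with the principal value of
  \<open>u0^a\<close> and the binomial series for the last factor. It is a power series precisely when
  \<open>d * a\<close> is a natural number, and that is always so if \<open>d = 0\<close> or if \<open>a\<close> is a natural number.
  Otherwise there is no expansion in nonnegative integer powers, and the value is 0 by convention.
\<close>

definition fps_cpowr :: "complex fps \<Rightarrow> complex \<Rightarrow> complex fps" where
  "fps_cpowr f a =
    (let d = subdegree f; u = unit_factor f; u0 = fps_nth u 0 in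
     if of_nat d * a \<in> \<nat>
     then fps_X ^ nat \<lfloor>Re (of_nat d * a)\<rfloor> * fps_const (u0 powr a) *
            (fps_binomial a oo (fps_const (inverse u0) * u - 1))
     else 0)"

definition fps_polylog :: "int \<Rightarrow> complex fps" where
  "fps_polylog k = Abs_fps (\<lambda>r. if r = 0 then 0 else 1 / (of_nat r powi k))"

text \<open>
  In the two quotients below numerator and denominator may both vanish at 0; division of power
  series cancels the common power of \<open>X\<close>. The argument \<open>m\<close> stands for the upper index \<open>m - 1\<close>
  of the usual notation.
\<close>

definition GABPDP_gf ::
  "int \<Rightarrow> nat \<Rightarrow> complex \<Rightarrow> real \<Rightarrow> real \<Rightarrow> real \<Rightarrow> complex fps" where
  "GABPDP_gf k m a \<gamma> \<eta> lam =
     fps_binomial (of_real \<gamma>) *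
     (fps_ln 1 / (fps_polylog k oo (1 - fps_exp (-1)))) *
     fps_exp (of_real \<eta>) *
     fps_cpowr
       (fps_X ^ m /
         (fps_const (of_real lam) * fps_exp 1 - (\<Sum>l<m. fps_const (1 / fact l) * fps_X ^ l))) a"

definition GABPDP ::
  "int \<Rightarrow> nat \<Rightarrow> complex \<Rightarrow> nat \<Rightarrow> real \<Rightarrow> real \<Rightarrow> real \<Rightarrow> complex" where
  "GABPDP k m a n \<gamma> \<eta> lam = fact n * fps_nth (GABPDP_gf k m a \<gamma> \<eta> lam) n"

lemma GABPDP_generating_function:
  "Abs_fps (\<lambda>n. GABPDP k m a n \<gamma> \<eta> lam / fact n) = GABPDP_gf k m a \<gamma> \<eta> lam"
  by (simp add: GABPDP_def fps_eq_iff)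

lemma fps_cpowr_of_nat:
  assumes "f \<noteq> 0"
  shows "fps_cpowr f (of_nat n) = f ^ n"
proof -
  define u where "u = unit_factor f"
  define u0 where "u0 = fps_nth u 0"
  define d where "d = subdegree f"
  have u0: "u0 \<noteq> 0"
    unfolding u0_def u_def by (rule fps_unit_factor_nth_0 [OF assms])
  have f: "f = fps_X ^ d * u"
    unfolding u_def d_def by (rule fps_unit_factor_decompose')
  have c: "fps_nth (fps_const (inverse u0) * u - 1) 0 = 0"
    using u0 by (simp add: u0_def)
  have "fps_binomial (of_nat n) oo (fps_const (inverse u0) * u - 1) =
        ((1 + fps_X) oo (fps_const (inverse u0) * u - 1)) ^ n"
    using c by (simp only: fps_binomial_of_nat fps_compose_power)
  also have "\<dots> = (fps_const (inverse u0) * u) ^ n"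
    by (simp only: fps_compose_add_distrib fps_X_fps_compose_startby0 [OF c] fps_compose_1) simp
  finally have *: "fps_binomial (of_nat n) oo (fps_const (inverse u0) * u - 1) =
        (fps_const (inverse u0) * u) ^ n" .
  have inv: "u0 ^ n * inverse u0 ^ n = 1"
    using u0 by (simp flip: power_mult_distrib)
  have **: "fps_const (u0 powr of_nat n) * (fps_const (inverse u0) * u) ^ n = u ^ n"
    using u0 by (simp add: powr_nat' power_mult_distrib fps_const_power mult.assoc [symmetric]
      inv del: power_inverse)
  have dn: "of_nat d * of_nat n = (of_nat (d * n) :: complex)" by simp
  have "fps_cpowr f (of_nat n) = fps_X ^ (d * n) *
      (fps_const (u0 powr of_nat n) * (fps_const (inverse u0) * u) ^ n)"
    unfolding fps_cpowr_def Let_def u_def [symmetric] d_def [symmetric] u0_def [symmetric] * dn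
    by (simp add: mult.assoc nat_mult_distrib flip: of_nat_mult)
  also have "\<dots> = f ^ n"
    unfolding ** by (subst f) (simp only: power_mult_distrib power_mult)
  finally show ?thesis .
qed

lemma fps_cpowr_add:
  assumes "fps_nth f 0 \<noteq> 0"
  shows "fps_cpowr f (a + b) = fps_cpowr f a * fps_cpowr f b"
proof -
  have d: "subdegree f = 0" using assms by (simp add: subdegree_eq_0)
  define g where "g = fps_const (inverse (fps_nth f 0)) * f - 1"
  have c: "fps_nth g 0 = 0"
    using assms by (simp add: g_def)
  have u: "fps_cpowr f s = fps_const (fps_nth f 0 powr s) * (fps_binomial s oo g)" for s
    by (simp add: fps_cpowr_def d Let_def g_def)
  show ?thesis
    by (simp add: u powr_add fps_binomial_add_mult fps_compose_mult_distrib [OF c] mult_ac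
        flip: fps_const_mult)
qed

end

theory Submission
  imports Defs
begin

text \<open>
  Replacing \<open>\<omega>\<close> by \<open>\<eta>\<close> multiplies the generating function by \<open>exp ((\<eta> - \<omega>) x)\<close>, which gives a
  binomial formula with a single sum over \<open>s\<close> of weight \<open>(b + c) choose s\<close>. Vandermonde's
  convolution splits this weight along \<open>s = n + q\<close>.
\<close>

text \<open>Pascal's rule, with the half of weight \<open>b choose (n - 1)\<close> reindexed so that
  it carries \<open>f (Suc n)\<close>. For the shift E it reads (1 + E)^(b+1) = (1 + E)^b (1 + E),
  applied to \<open>f\<close> at 0.\<close>

lemma sum_choose_Suc:
  fixes f :: "nat \<Rightarrow> 'a :: comm_semiring_1"
  shows "(\<Sum>n\<le>Suc b. of_nat (Suc b choose n) * f n) =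
    (\<Sum>n\<le>b. of_nat (b choose n) * (f n + f (Suc n)))"
proof -
  \<comment> \<open>The added term is 0; it lets the index shift below end at \<open>b\<close>
    again.\<close>
  have "(\<Sum>n\<le>b. of_nat (b choose n) * f n) = (\<Sum>n\<le>Suc b. of_nat (b choose n) * f n)"
    by (simp add: binomial_eq_0)
  also have "\<dots> = f 0 + (\<Sum>n\<le>b. of_nat (b choose Suc n) * f (Suc n))"
    by (simp only: sum.atMost_Suc_shift binomial_n_0 of_nat_1 mult_1)
  finally show ?thesis
    by (simp only: sum.atMost_Suc_shift binomial_n_0 of_nat_1 mult_1 binomial_Suc_Suc of_nat_add
        distrib_left distrib_right sum.distrib add_ac)
qed

text \<open>Vandermonde in operator form: (1 + E)^(b+c) = (1 + E)^b (1 + E)^c. The induction peels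
  off one factor 1 + E, so \<open>f\<close> must vary.\<close>

lemma sum_choose_add:
  fixes f :: "nat \<Rightarrow> 'a :: comm_semiring_1"
  shows "(\<Sum>s\<le>b + c. of_nat ((b + c) choose s) * f s) =
    (\<Sum>n\<le>b. \<Sum>q\<le>c. of_nat (b choose n) * of_nat (c choose q) * f (n + q))"
proof (induction b arbitrary: f)
  case 0
  show ?case by simp
next
  case (Suc b)
  \<comment> \<open>The induction hypothesis is used for the function
    \<open>f s + f (Suc s)\<close>.\<close>
  have "(\<Sum>s\<le>Suc b + c. of_nat ((Suc b + c) choose s) * f s) =
      (\<Sum>n\<le>b. \<Sum>q\<le>c. of_nat (b choose n) * of_nat (c choose q) * (f (n + q) + f (Suc (n + q))))"
    unfolding add_Suc sum_choose_Suc by (rule Suc.IH)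
  also have "\<dots> = (\<Sum>n\<le>b. of_nat (b choose n) *
      ((\<Sum>q\<le>c. of_nat (c choose q) * f (n + q)) + (\<Sum>q\<le>c. of_nat (c choose q) * f (Suc n + q))))"
    by (simp add: sum_distrib_left distrib_left mult.assoc flip: sum.distrib)
  \<comment> \<open>Pascal's rule backwards, with the whole inner sum over \<open>q\<close> as the
    function of \<open>n\<close>.\<close>
  also have "\<dots> = (\<Sum>n\<le>Suc b. of_nat (Suc b choose n) * (\<Sum>q\<le>c. of_nat (c choose q) * f (n + q)))"
    by (rule sum_choose_Suc [symmetric])
  finally show ?case
    by (simp only: sum_distrib_left mult.assoc)
qed

lemma GABPDP_gf_shift:
  "GABPDP_gf k m a \<gamma> \<eta> lam = fps_exp (of_real (\<eta> - \<omega>)) * GABPDP_gf k m a \<gamma> \<omega> lam"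
proof -
  have "fps_exp (of_real \<eta> :: complex) = fps_exp (of_real (\<eta> - \<omega>)) * fps_exp (of_real \<omega>)"
    by (simp flip: fps_exp_add_mult)
  then show ?thesis
    by (simp only: GABPDP_gf_def mult_ac)
qed

text \<open>Compares coefficients in the Cauchy product: \<open>fact n\<close> over
  \<open>fact s * fact (n - s)\<close> is the binomial weight.\<close>

lemma GABPDP_shift:
  "GABPDP k m a n \<gamma> \<eta> lam =
    (\<Sum>s\<le>n. of_nat (n choose s) * (of_real (\<eta> - \<omega>) ^ s * GABPDP k m a (n - s) \<gamma> \<omega> lam))"
  unfolding GABPDP_def GABPDP_gf_shift [of k m a \<gamma> \<eta> lam \<omega>] fps_mult_nth sum_distrib_left
    atLeast0AtMost
  by (intro sum.cong refl) (simp add: binomial_fact field_simps)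

theorem theorem3p1:
  fixes \<gamma> \<eta> \<omega> lam :: real and a :: complex and k :: int and m b c :: nat
  assumes "m \<ge> 1"
  shows "GABPDP k m a (b + c) \<gamma> \<eta> lam =
    (\<Sum>n=0..b. \<Sum>q=0..c.
       of_nat (b choose n) * of_nat (c choose q) * of_real (\<eta> - \<omega>) ^ (n + q) *
       GABPDP k m a (b + c - n - q) \<gamma> \<omega> lam)"
  \<comment> \<open>Power and polynomial together form one function of \<open>s\<close>, so the
    splitting puts \<open>n + q\<close> into both.\<close>
  unfolding GABPDP_shift [of k m a "b + c" \<gamma> \<eta> lam \<omega>] sum_choose_add atLeast0AtMost
  by (simp only: diff_diff_left mult.assoc)

end
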